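(* Let $\mathbf P=(P,\leq)$ be a poset and $a,b\in P$ with $a\neq b$. Define $f_{ab}\colon P\to P$ by $f_{ab}(a)=b$ and $f_{ab}(x)=x$ for $x\neq a$. Then $f_{ab}$ is upper cone preserving if and only if $a$ is a minimal element of $\mathbf P$ and $U^*(a)=U(b)$.
   Context: For $A\subseteq P$, $U(A)=\{x\in P\mid a\leq x\text{ for all }a\in A\}$; write $U(x,y)=U(\{x,y\})$, $U(x)=U(\{x\})$, and $U^*(x)=U(x)\setminus\{x\}$. A mapping $f\colon P\to P$ is upper cone preserving if $f(U(x,y))=U(f(x),f(y))$ for all $x,y\in P$. *)

theory Defs
  imports Main
begin

definition upper_cone :: "'a::order set \<Rightarrow> 'a set" where
  "upper_cone A = {x. \<forall>a\<in>A. a \<le> x}"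

definition strict_upper_cone :: "'a::order \<Rightarrow> 'a set" where
  "strict_upper_cone x = upper_cone {x} - {x}"

definition upper_cone_preserving :: "('a::order \<Rightarrow> 'a) \<Rightarrow> bool" where
  "upper_cone_preserving f \<longleftrightarrow>
     (\<forall>x y. f ` upper_cone {x, y} = upper_cone {f x, f y})"

definition minimal_elem :: "'a::order \<Rightarrow> bool" where
  "minimal_elem a \<longleftrightarrow> \<not> (\<exists>x. x < a)"

definition f_ab :: "'a \<Rightarrow> 'a \<Rightarrow> 'a \<Rightarrow> 'a" where
  "f_ab a b x = (if x = a then b else x)"

end

theory Submission
  imports Defs
begin

text \<open>The value \<open>a\<close> is never taken by \<open>f_ab a b\<close>, so under
  preservation it lies in no cone of the form U(f x, f y); this forces minimality. Comparing the
  image of U(a), which is U*(a) together with b, with U(b) gives the cone equation once a < b is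
  known. Conversely, a minimal \<open>a\<close> lies in U(x,y) only if x = y = a, so every other
  such cone is fixed pointwise, and trading \<open>a\<close> for \<open>b\<close> as a generator
  only removes the point \<open>a\<close>, which is not there.\<close>

theorem theorem3p2:
  fixes a b :: "'a::order"
  assumes "a \<noteq> b"
  shows "upper_cone_preserving (f_ab a b) \<longleftrightarrow>
    minimal_elem a \<and> strict_upper_cone a = upper_cone {b}"
proof
  let ?f = "f_ab a b"
  assume "upper_cone_preserving ?f"
  then have pres: "?f ` upper_cone {x, y} = upper_cone {?f x, ?f y}" for x y
    unfolding upper_cone_preserving_def by blast
  have a_notin: "a \<notin> ?f ` S" for S
    using assms by (auto simp: f_ab_def)
  have min: "minimal_elem a"
    unfolding minimal_elem_def
  proof
    assume "\<exists>x. x < a"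
    then obtain x where "x < a" ..
    then have "a \<in> upper_cone {?f x, ?f x}"
      by (auto simp: upper_cone_def f_ab_def)
    then show False
      using pres[of x x] a_notin by metis
  qed
  \<comment> \<open>Both \<open>a\<close> and \<open>b\<close> are sent to \<open>b\<close>, so this
    image is U(b). A preimage of \<open>b\<close> in it is \<open>a\<close> or \<open>b\<close>; the
    first would give b < a, against minimality, and the second gives a < b.\<close>
  have "b \<in> ?f ` upper_cone {a, b}"
    unfolding pres by (simp add: upper_cone_def f_ab_def)
  then have "a < b"
    using assms min
    by (auto simp: upper_cone_def f_ab_def minimal_elem_def order.strict_iff_order split: if_splits)
  moreover have "upper_cone {b} = ?f ` upper_cone {a}"
    using pres[of a a] by (simp add: f_ab_def)
  moreover have "?f ` upper_cone {a} = insert b (strict_upper_cone a)"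
    by (auto simp: strict_upper_cone_def upper_cone_def f_ab_def image_iff)
  ultimately have "strict_upper_cone a = upper_cone {b}"
    by (auto simp: strict_upper_cone_def upper_cone_def)
  with min show "minimal_elem a \<and> strict_upper_cone a = upper_cone {b}" ..
next
  let ?f = "f_ab a b"
  assume "minimal_elem a \<and> strict_upper_cone a = upper_cone {b}"
  then have min: "x \<le> a \<Longrightarrow> x = a"
    and cone: "b \<le> x \<longleftrightarrow> a \<le> x \<and> x \<noteq> a" for x
    by (auto simp: minimal_elem_def strict_upper_cone_def upper_cone_def order.order_iff_strict set_eq_iff)
  show "upper_cone_preserving ?f"
    unfolding upper_cone_preserving_def
  proof (intro allI)
    fix x y
    show "?f ` upper_cone {x, y} = upper_cone {?f x, ?f y}"
    proof (cases "x = a \<and> y = a")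
      case True
      have "?f ` upper_cone {a} = upper_cone {b}"
        using cone by (auto simp: upper_cone_def f_ab_def image_iff)
      with True show ?thesis
        by (simp add: f_ab_def)
    next
      case False
      then have "a \<notin> upper_cone {x, y}"
        using min by (auto simp: upper_cone_def)
      then have "?f ` upper_cone {x, y} = upper_cone {x, y}"
        by (force simp: f_ab_def image_iff)
      \<comment> \<open>If exactly one generator is \<open>a\<close>, minimality keeps
        \<open>a\<close> itself out of the cone, so there \<open>cone\<close> makes lying above
        \<open>a\<close> the same as lying above \<open>b\<close>.\<close>
      also have "\<dots> = upper_cone {?f x, ?f y}"
        using False min cone by (auto simp: upper_cone_def f_ab_def)
      finally show ?thesis .
    qed
  qed
qed

end
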